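(* Let $f:\mathbb{R}^n\to\mathbb{R}$ be continuously differentiable (no convexity is assumed), and let $\zeta>0$, $\delta\in(0,1)$, $\sigma\in(\delta,1)$, $m>0$, $M>0$ and $x_0\in\mathbb{R}^n$. Consider any run of Algorithm MSTTMHS (defined in the context) applied to $f$ with these parameters and starting point, producing iterates $x_k$, gradients $g_k=\nabla f(x_k)$ and search directions $d_k$. Then the sufficient descent condition holds: there is a constant $\varsigma>0$, independent of $k$, such that $$g_k^Td_k\le-\varsigma\,\|g_k\|^2$$ for every $k\ge 0$ for which $d_k$ is generated.
   Context: $\|\cdot\|$ is the Euclidean norm. Algorithm MSTTMHS (modified spectral three-term extension of the modified Hestenes--Stiefel method) for minimizing a continuously differentiable $f:\mathbb{R}^n\to\mathbb{R}$. Parameters: $x_0\in\mathbb{R}^n$, $\zeta>0$, $\delta\in(0,1)$, $\sigma\in(\delta,1)$, and a lower bound $m>0$ and an upper bound $M>0$ for the spectral parameter. Write $g_k=\nabla f(x_k)$. Set $d_0=-g_0$. For $k=0,1,2,\dots$, as long as $g_k\neq 0$: 1. Choose a step length $\alpha_k>0$ satisfying the Wolfe conditions $$f(x_k+\alpha_kd_k)-f(x_k)\le\delta\,\alpha_k\,g_k^Td_k,\qquad \nabla f(x_k+\alpha_kd_k)^Td_k\ge\sigma\,g_k^Td_k .$$ 2. Set $s_k=\alpha_kd_k$, $x_{k+1}=x_k+s_k$, $y_k=g_{k+1}-g_k$ and $$z_k=y_k+\zeta\frac{\|y_k\|}{\|s_k\|}s_k,\qquad\text{so that } s_k^Tz_k=s_k^Ty_k+\zeta\|y_k\|\|s_k\|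 .$$ 3. If $g_{k+1}\ne0$, compute $$\eta_k^*=1-2\frac{(g_{k+1}^Ty_k)(g_{k+1}^Ts_k)}{\|g_{k+1}\|^2(s_k^Tz_k)}+\left(1+\frac{\|y_k\|^2}{s_k^Tz_k}\right)\frac{(g_{k+1}^Ts_k)^2}{\|g_{k+1}\|^2(s_k^Tz_k)},\qquad \bar\eta_k=\max\{m,\min\{M,\eta_k^*\}\},$$ and the next search direction $$d_{k+1}=-\bar\eta_k\,g_{k+1}+\frac{g_{k+1}^Ty_k}{s_k^Tz_k}\,s_k-\frac{g_{k+1}^Ts_k}{s_k^Tz_k}\,y_k .$$ The run stops at the first $k$ with $g_k=0$, if any. In the run considered, step lengths satisfying the Wolfe conditions are assumed to have been found at every iteration performed. *)

theory Defs
  imports "HOL-Analysis.Analysis"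
begin

definition C1_with_gradient :: "(real^'n \<Rightarrow> real) \<Rightarrow> (real^'n \<Rightarrow> real^'n) \<Rightarrow> bool" where
  "C1_with_gradient f gf \<longleftrightarrow> (\<forall>x. GDERIV f x :> gf x) \<and> continuous_on UNIV gf"

definition wolfe_conditions ::
  "(real^'n \<Rightarrow> real) \<Rightarrow> (real^'n \<Rightarrow> real^'n) \<Rightarrow> real \<Rightarrow> real
    \<Rightarrow> real^'n \<Rightarrow> real^'n \<Rightarrow> real \<Rightarrow> bool" where
  "wolfe_conditions f gf \<delta> \<sigma> x d \<alpha> \<longleftrightarrow>
     f (x + \<alpha> *\<^sub>R d) - f x \<le> \<delta> * \<alpha> * (gf x \<bullet> d) \<and>
     gf (x + \<alpha> *\<^sub>R d) \<bullet> d \<ge> \<sigma> * (gf x \<bullet> d)"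

definition modified_diff :: "real \<Rightarrow> real^'n \<Rightarrow> real^'n \<Rightarrow> real^'n" where
  "modified_diff \<zeta> s y = y + (\<zeta> * (norm y / norm s)) *\<^sub>R s"

text \<open>
  In the following three definitions, \<^term>\<open>g\<close> is the new gradient (index $k+1$), while
  \<^term>\<open>s\<close> and \<^term>\<open>y\<close> are the step and the gradient difference of iteration $k$.
\<close>

definition spectral_param :: "real \<Rightarrow> real^'n \<Rightarrow> real^'n \<Rightarrow> real^'n \<Rightarrow> real" where
  "spectral_param \<zeta> g s y =
     (let sz = s \<bullet> modified_diff \<zeta> s y in
       1 - 2 * ((g \<bullet> y) * (g \<bullet> s)) / ((norm g)\<^sup>2 * sz)
         + (1 + (norm y)\<^sup>2 / sz) * ((g \<bullet> s)\<^sup>2 / ((norm g)\<^sup>2 * sz)))"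

definition truncated_spectral_param ::
  "real \<Rightarrow> real \<Rightarrow> real \<Rightarrow> real^'n \<Rightarrow> real^'n \<Rightarrow> real^'n \<Rightarrow> real" where
  "truncated_spectral_param \<zeta> m M g s y = max m (min M (spectral_param \<zeta> g s y))"

definition next_direction ::
  "real \<Rightarrow> real \<Rightarrow> real \<Rightarrow> real^'n \<Rightarrow> real^'n \<Rightarrow> real^'n \<Rightarrow> real^'n" where
  "next_direction \<zeta> m M g s y =
     (let sz = s \<bullet> modified_diff \<zeta> s y in
       - (truncated_spectral_param \<zeta> m M g s y *\<^sub>R g)
         + ((g \<bullet> y) / sz) *\<^sub>R s
         - ((g \<bullet> s) / sz) *\<^sub>R y)"

definition iteration_performed :: "(real^'n \<Rightarrow> real^'n) \<Rightarrow> (nat \<Rightarrow> real^'n) \<Rightarrow> nat \<Rightarrow> bool" where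
  "iteration_performed gf x k \<longleftrightarrow> (\<forall>j\<le>k. gf (x j) \<noteq> 0)"

text \<open>
  A run is encoded by total sequences of step lengths, iterates and directions. The run may
  terminate, so the sequences are constrained only up to the first vanishing gradient; the
  values beyond that point are arbitrary and not part of the run.
\<close>

definition MSTTMHS_run ::
  "(real^'n \<Rightarrow> real) \<Rightarrow> (real^'n \<Rightarrow> real^'n) \<Rightarrow> real \<Rightarrow> real \<Rightarrow> real \<Rightarrow> real \<Rightarrow> real \<Rightarrow> real^'n
    \<Rightarrow> (nat \<Rightarrow> real) \<Rightarrow> (nat \<Rightarrow> real^'n) \<Rightarrow> (nat \<Rightarrow> real^'n) \<Rightarrow> bool" where
  "MSTTMHS_run f gf \<zeta> \<delta> \<sigma> m M x0 \<alpha> x d \<longleftrightarrow>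
     x 0 = x0 \<and> d 0 = - gf (x 0) \<and>
     (\<forall>k. iteration_performed gf x k \<longrightarrow>
        \<alpha> k > 0 \<and> wolfe_conditions f gf \<delta> \<sigma> (x k) (d k) (\<alpha> k) \<and>
        (let s = \<alpha> k *\<^sub>R d k; y = gf (x (Suc k)) - gf (x k) in
          x (Suc k) = x k + s \<and>
          (gf (x (Suc k)) \<noteq> 0 \<longrightarrow>
             d (Suc k) = next_direction \<zeta> m M (gf (x (Suc k))) s y)))"

text \<open>
  The initial direction is always generated, even if the initial gradient vanishes; a later
  direction is generated only if the gradient at its own index is nonzero as well.
\<close>

definition direction_generated :: "(real^'n \<Rightarrow> real^'n) \<Rightarrow> (nat \<Rightarrow> real^'n) \<Rightarrow> nat \<Rightarrow> bool" where
  "direction_generated gf x k \<longleftrightarrow> k = 0 \<or> (\<forall>j\<le>k. gf (x j) \<noteq> 0)"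

end

theory Submission
  imports Defs
begin

text \<open>The three-term direction is built so that its last two terms cancel against the new
  gradient: with s and y exchanged, the products (g.y)(g.s)/(s.z) enter with opposite signs and a
  common denominator, so they cancel for every value of it, 0 included. Only the spectral term
  survives (\<open>inner_next_direction\<close>), and its coefficient is truncated from below at
  \<open>m\<close>. Descent is thus an identity with a uniformly bounded coefficient.\<close>

lemma inner_next_direction:
  "g \<bullet> next_direction \<zeta> m M g s y = - truncated_spectral_param \<zeta> m M g s y * (norm g)\<^sup>2"
  by (simp add: next_direction_def Let_def inner_diff_right inner_add_right power2_norm_eq_inner)

theorem lemma3p1:
  fixes f :: "real^'n \<Rightarrow> real" and gf :: "real^'n \<Rightarrow> real^'n"
    and \<zeta> \<delta> \<sigma> m M :: real and x0 :: "real^'n"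
    and \<alpha> :: "nat \<Rightarrow> real" and x d :: "nat \<Rightarrow> real^'n"
  assumes "C1_with_gradient f gf"
    and "\<zeta> > 0" and "0 < \<delta>" and "\<delta> < 1" and "\<delta> < \<sigma>" and "\<sigma> < 1"
    and "m > 0" and "M > 0"
    and "MSTTMHS_run f gf \<zeta> \<delta> \<sigma> m M x0 \<alpha> x d"
  shows "\<exists>\<epsilon>>0. \<forall>k. direction_generated gf x k \<longrightarrow>
           gf (x k) \<bullet> d k \<le> - \<epsilon> * (norm (gf (x k)))\<^sup>2"
proof (intro exI conjI allI impI)
  \<comment> \<open>The 1 serves the steepest descent start \<open>d 0\<close>, the \<open>m\<close>
    all later directions.\<close>
  show "min 1 m > 0" using \<open>m > 0\<close> by simp
next
  fix k assume generated: "direction_generated gf x k"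
  have "\<exists>\<eta> \<ge> min 1 m. gf (x k) \<bullet> d k = - \<eta> * (norm (gf (x k)))\<^sup>2"
  proof (cases k)
    case 0
    have "d 0 = - gf (x 0)"
      using assms(9) by (simp add: MSTTMHS_run_def)
    then show ?thesis
      using 0 by (intro exI[of _ 1]) (simp add: power2_norm_eq_inner)
  next
    case (Suc j)
    define s y where "s = \<alpha> j *\<^sub>R d j" and "y = gf (x (Suc j)) - gf (x j)"
    \<comment> \<open>A direction generated at \<open>Suc j\<close> has nonzero gradients up to and
      including \<open>Suc j\<close>; this supplies both guards under which the run defines
      \<open>d (Suc j)\<close>.\<close>
    have "iteration_performed gf x j" "gf (x (Suc j)) \<noteq> 0"
      using generated Suc by (auto simp: direction_generated_def iteration_performed_def)
    then have "d k = next_direction \<zeta> m M (gf (x k)) s y"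
      using assms(9) Suc unfolding MSTTMHS_run_def Let_def s_def y_def by blast
    \<comment> \<open>The outer \<open>max\<close> bounds the parameter below by \<open>m\<close>,
      whatever the inner \<open>min\<close> returns.\<close>
    moreover have "truncated_spectral_param \<zeta> m M (gf (x k)) s y \<ge> min 1 m"
      by (simp add: truncated_spectral_param_def)
    ultimately show ?thesis
      using inner_next_direction by metis
  qed
  then obtain \<eta> where "min 1 m \<le> \<eta>" and descent: "gf (x k) \<bullet> d k = - \<eta> * (norm (gf (x k)))\<^sup>2"
    by blast
  then show "gf (x k) \<bullet> d k \<le> - min 1 m * (norm (gf (x k)))\<^sup>2"
    unfolding descent by (intro mult_right_mono) simp_all
qed

end
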